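(* Suppose that at time $t$ a mode change from $\mu$ to $\bar\mu$ is detected, and $x(t)\in\mathcal R_{\bar\mu}^{T_r}$. Then the auxiliary reference (AR) sequence $v(t),\dots,v(t+T_r-1)$ computed via the optimization problem $$\min_{v(t),\dots,v(t+T_r-1)}\ \sum_{i=0}^{T_r-1}\|v(t+i)-r\|_R^2$$ subject to $\hat z_1(i|t,\bar\mu)\in\mathcal Z_1^+$ and $\hat z_2(i|t,\bar\mu)\in\mathcal Z_2^+\sim\mathcal P_\beta(i)$ for all $i\in\{0,\dots,T_r-1\}$, and $(\hat x(T_r|t,\bar\mu),v(t+T_r-1))\in\mathrm{Proj}_{(x,v_0)}\tilde O_{\infty,\bar\mu}$, provides a safe reconfiguration; that is, such an AR sequence exists, and it keeps the relaxed constraints enforced over the $T_r$ recovery steps and brings the predicted pair $(\hat x(T_r|t,\bar\mu),v(t+T_r-1))$ into $\mathrm{Proj}_{(x,v_0)}\tilde O_{\infty,\bar\mu}$, associated with the new mode $\bar\mu$.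
   Context: Multi-mode closed-loop system: for each mode $\mu$ in a finite set $\mathcal M$, $x(t+1|\mu)=A_\mu x(t|\mu)+B_\mu v(t)+\omega_\mu(t)$, $y(t|\mu)=Cx(t|\mu)+\xi(t)$, where $A_\mu=A_{o,\mu}+B_{o,\mu}K_\mu$ is strictly Schur and $B_\mu=B_{o,\mu}G_\mu$ (control law $u=K_\mu x+G_\mu v$), $x\in\mathbb{R}^n$, AR $v(t)\in\mathbb{R}^m$, and $\omega_\mu,\xi$ mutually independent zero-mean Gaussian processes with covariances $H_{\omega_\mu},H_\xi$. Constrained outputs: $z_1(t|\mu)=L_xx(t|\mu)+L_vv(t)+\zeta(t)\in\mathbb{R}^{n_e}$, $z_2(t|\mu)=F_xx(t|\mu)+F_vv(t)+\varsigma(t)\in\mathbb{R}^{n_c}$, $\zeta(t)\sim\mathcal N(0,H_\zeta)$, $\varsigma(t)\sim\mathcal N(0,H_\varsigma)$. Nominal constraints: $\mathbb{E}[z_1(t|\mu)]\in\mathcal Z_1$, $\mathbb{P}(z_2(t|\mu)\in\mathcal Z_2)\ge\beta$, with $\mathcal Z_1,\mathcal Z_2$ compact, convex, containing the origin. The pairs $(L_x,A_\mu)$, $(F_x,A_\mu)$ are observable for all $\mu$. Standing assumptions: (i) the time between subsequent faults is large, so only one mode change needs to be considered at a time; (ii) constraints can be temporarily relaxed to $\mathbb{E}[z_1(t|\mu)]\in\mathcal Z_1^+$ and $\mathbb{P}(z_2(t|\mu)\in\mathcal Z_2^+)\ge\beta$, with extended sets $\mathcal Z_1^+\supset\mathcal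 Z_1$, $\mathcal Z_2^+\supset\mathcal Z_2$, for at most $T_e\in\mathbb{Z}_{\ge2}$ time steps. $T_r$ with $0<T_r<T_e$ is the specified recovery time, within which the system should enter a safe configuration. $r\in\mathbb{R}^m$ is the desired reference and $R=R^\top>0$, $\|v\|_R^2=v^\top Rv$. Notation: $X\oplus Y$ is the Minkowski sum (points identified with singletons), $X\sim Y=\{x:x+y\in X\ \forall y\in Y\}$ the Pontryagin difference, $\mathcal B_\epsilon$ the open ball of fixed radius $\epsilon>0$ about the origin, and $\mathrm{Proj}_{(x,v_0)}$ projection onto the $(x,v_0)$ coordinates. Predictions for mode $\mu$: noise-free $\hat x(k+1|t,\mu)=A_\mu\hat x(k|t,\mu)+B_\mu v(t+k)$, $\hat x(0|t,\mu)=x(t)$, $\hat z_1(k|t,\mu)=L_x\hat x(k|t,\mu)+L_vv(t+k)$, $\hat z_2(k|t,\mu)=F_x\hat x(k|t,\mu)+F_vv(t+k)$; noise-driven $\tilde x(k+1|t)=A_\mu\tilde x(k|t)+\omega_\mu(t+k)$, $\tilde x(0|t)=0$, $\tilde z_2(k|t)=F_x\tilde x(k|t)+\varsigma(t+k)$. $\mathcal P_\beta(k)$ is the confidence ellipsoid of level $\beta$: $\mathbb{P}(\tilde z_2(k|t)\in\mathcal P_\beta(k))=\beta$ (for the mode under consideration). Set $\tilde O_{\infty,\mu}$: fix an integer horizon $T>0$. For $x\in\mathbb{R}^n$, $v_0,\dots,v_T\in\mathbb{R}^m$, let $\hat x_T$ be the noise-free prediction at step $T$ from $x$ under $v_0,\dots,v_{T-1}$,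 and for $k\ge0$ let $\hat z_1(k|x,v_0,\dots,v_T)=L_xA_\mu^k(\hat x_T-(I_n-A_\mu)^{-1}B_\mu v_T)+(L_x(I_n-A_\mu)^{-1}B_\mu+L_v)v_T$ and $\hat z_2(k|x,v_0,\dots,v_T)=F_xA_\mu^k(\hat x_T-(I_n-A_\mu)^{-1}B_\mu v_T)+(F_x(I_n-A_\mu)^{-1}B_\mu+F_v)v_T$. Let $\Phi_k$ be the set of $(x,v_0,\dots,v_T)$ with $\hat z_1(k|x,v_0,\dots,v_T)\in\mathcal Z_1$ and $\hat z_2(k|x,v_0,\dots,v_T)\in\mathcal Z_2\sim\mathcal P_\beta(k)$; let $\bar\Phi$ be the set of $(x,v_0,\dots,v_T)$ such that the noise-free predicted outputs from $x$ under $v_0,\dots,v_T$ lie in $\mathcal Z_1$ and in $\mathcal Z_2\sim\mathcal P_\beta(k)$, respectively, for $k=0,\dots,T$, and $(L_x(I_n-A_\mu)^{-1}B_\mu+L_v)v_T\oplus\mathcal B_\epsilon\subset\mathcal Z_1$, $(F_x(I_n-A_\mu)^{-1}B_\mu+F_v)v_T\oplus\mathcal B_\epsilon\subset\bigcap_{k\ge0}(\mathcal Z_2\sim\mathcal P_\beta(k))$. Then $\tilde O_{\infty,\mu}=\bar\Phi\cap\bigcap_{k\ge0}\Phi_k$. Recoverable set: $\mathcal R_\mu^{T_r}$ is the set of states $x(t)$ for which there exist $v(t),\dots,v(t+T_r-1)$ such that $\hat z_1(k|t,\mu)\in\mathcal Z_1^+$ and $\hat z_2(k|t,\mu)\in\mathcal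 Z_2^+\sim\mathcal P_\beta(k)$ for all $k\in\{0,\dots,T_r-1\}$, and $(\hat x(T_r|t,\mu),v(t+T_r-1))\in\mathrm{Proj}_{(x,v_0)}\tilde O_{\infty,\mu}$.
   Formalization: The extended sets Z_1^+ and Z_2^+ are additionally assumed closed; without this the minimum need not be attained (e.g. an open interval Z_1^+ with the reference r outside it), so the claimed AR sequence need not exist. *)

theory Defs
  imports "HOL-Probability.Probability" "HOL-Library.Set_Algebras"
begin

section \<open>Linear systems\<close>

definition schur_matrix :: "real^'n^'n \<Rightarrow> bool" where
  "schur_matrix A \<longleftrightarrow>
     (\<forall>(l::complex) (z::complex^'n). z \<noteq> 0 \<and> map_matrix complex_of_real A *v z = l *s z \<longrightarrow> cmod l < 1)"

definition observable :: "real^'n^'p \<Rightarrow> real^'n^'n \<Rightarrow> bool" where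
  "observable L A \<longleftrightarrow>
     (\<forall>x y. (\<forall>k. L *v (((*v) A ^^ k) x) = L *v (((*v) A ^^ k) y)) \<longrightarrow> x = y)"

definition pos_def_matrix :: "real^'m^'m \<Rightarrow> bool" where
  "pos_def_matrix R \<longleftrightarrow> transpose R = R \<and> (\<forall>a. a \<noteq> 0 \<longrightarrow> a \<bullet> (R *v a) > 0)"

definition pos_semidef_matrix :: "real^'m^'m \<Rightarrow> bool" where
  "pos_semidef_matrix H \<longleftrightarrow> transpose H = H \<and> (\<forall>a. a \<bullet> (H *v a) \<ge> 0)"

definition pontryagin_diff :: "'a::plus set \<Rightarrow> 'a set \<Rightarrow> 'a set" where
  "pontryagin_diff X Y = {x. \<forall>y\<in>Y. x + y \<in> X}"

section \<open>Gaussian noise\<close>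

text \<open>Zero-mean univariate normal variable of variance \<open>s\<close>; for \<open>s = 0\<close> it is the point mass
  at \<open>0\<close>, so that singular covariance matrices are allowed.\<close>

definition centred_normal :: "'w measure \<Rightarrow> real \<Rightarrow> ('w \<Rightarrow> real) \<Rightarrow> bool" where
  "centred_normal M s X \<longleftrightarrow> s \<ge> 0 \<and> X \<in> borel_measurable M \<and>
     (if s = 0 then (AE \<omega> in M. X \<omega> = 0)
      else distributed M lborel X (normal_density 0 (sqrt s)))"

definition gaussian_vector :: "'w measure \<Rightarrow> real^'d^'d \<Rightarrow> ('w \<Rightarrow> real^'d) \<Rightarrow> bool" where
  "gaussian_vector M H X \<longleftrightarrow> pos_semidef_matrix H \<and> X \<in> borel_measurable M \<and>
     (\<forall>a. centred_normal M (a \<bullet> (H *v a)) (\<lambda>\<omega>. a \<bullet> X \<omega>))"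

text \<open>Correlation between different times is left unconstrained; white noise is a special case.\<close>

definition gaussian_process ::
    "'w measure \<Rightarrow> real^'d^'d \<Rightarrow> (nat \<Rightarrow> 'w \<Rightarrow> real^'d) \<Rightarrow> bool" where
  "gaussian_process M H X \<longleftrightarrow> (\<forall>s. gaussian_vector M H (X s)) \<and>
     (\<forall>I a. finite I \<longrightarrow> (\<exists>c. centred_normal M c (\<lambda>\<omega>. \<Sum>s\<in>I. a s \<bullet> X s \<omega>)))"

definition process_events ::
    "'w measure \<Rightarrow> (nat \<Rightarrow> 'w \<Rightarrow> 'a::topological_space) \<Rightarrow> 'w set set" where
  "process_events M X =
     sets (vimage_algebra (space M) (\<lambda>\<omega> s. X s \<omega>) (\<Pi>\<^sub>M s\<in>UNIV. borel))"

definition covariance_matrix :: "'w measure \<Rightarrow> ('w \<Rightarrow> real^'d) \<Rightarrow> real^'d^'d" where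
  "covariance_matrix M X =
     (\<chi> i j. \<integral>\<omega>. (X \<omega> $ i - (\<integral>\<omega>'. X \<omega>' $ i \<partial>M)) * (X \<omega> $ j - (\<integral>\<omega>'. X \<omega>' $ j \<partial>M)) \<partial>M)"

text \<open>For invertible \<open>\<Sigma>\<close> the set \<open>ellipsoid \<Sigma> c\<close> is the set of all \<open>z\<close> with
  \<open>z\<^sup>T \<Sigma>\<^sup>-\<^sup>1 z \<le> c\<close> (take \<open>y = \<Sigma>\<^sup>-\<^sup>1 z\<close>); for singular \<open>\<Sigma>\<close>
  it is the corresponding degenerate ellipsoid in the range of \<open>\<Sigma>\<close>.\<close>

definition ellipsoid :: "real^'d^'d \<Rightarrow> real \<Rightarrow> (real^'d) set" where
  "ellipsoid \<Sigma> c = {\<Sigma> *v y | y. y \<bullet> (\<Sigma> *v y) \<le> c}"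

definition confidence_ellipsoid ::
    "'w measure \<Rightarrow> ('w \<Rightarrow> real^'d) \<Rightarrow> real \<Rightarrow> (real^'d) set \<Rightarrow> bool" where
  "confidence_ellipsoid M X \<beta> E \<longleftrightarrow>
     (\<exists>c\<ge>0. E = ellipsoid (covariance_matrix M X) c) \<and>
     measure M {\<omega> \<in> space M. X \<omega> \<in> E} = \<beta>"

section \<open>The multi-mode closed-loop system\<close>

text \<open>\<open>Z1r\<close> and \<open>Z2r\<close> are the extended (relaxed) constraint sets.\<close>

record ('mu, 'n, 'm, 'u, 'y, 'e, 'c) plant =
  modes :: "'mu set"
  A_open :: "'mu \<Rightarrow> real^'n^'n"
  B_open :: "'mu \<Rightarrow> real^'u^'n"
  K_gain :: "'mu \<Rightarrow> real^'n^'u"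
  G_gain :: "'mu \<Rightarrow> real^'m^'u"
  C_out :: "real^'n^'y"
  L_x :: "real^'n^'e"
  L_v :: "real^'m^'e"
  F_x :: "real^'n^'c"
  F_v :: "real^'m^'c"
  Z1 :: "(real^'e) set"
  Z2 :: "(real^'c) set"
  Z1r :: "(real^'e) set"
  Z2r :: "(real^'c) set"

definition A_cl where "A_cl S \<mu> = A_open S \<mu> + B_open S \<mu> ** K_gain S \<mu>"
definition B_cl where "B_cl S \<mu> = B_open S \<mu> ** G_gain S \<mu>"

text \<open>Of the extended sets only closedness is required, not compactness or convexity; some such
  assumption is needed for the recovery problem below to attain its minimum.\<close>

definition admissible_plant ::
    "('mu, 'n::finite, 'm::finite, 'u::finite, 'y::finite, 'e::finite, 'c::finite) plant \<Rightarrow> bool" where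
  "admissible_plant S \<longleftrightarrow> finite (modes S) \<and>
     (\<forall>\<mu>\<in>modes S. schur_matrix (A_cl S \<mu>) \<and>
        observable (L_x S) (A_cl S \<mu>) \<and> observable (F_x S) (A_cl S \<mu>)) \<and>
     compact (Z1 S) \<and> convex (Z1 S) \<and> 0 \<in> Z1 S \<and>
     compact (Z2 S) \<and> convex (Z2 S) \<and> 0 \<in> Z2 S \<and>
     closed (Z1r S) \<and> Z1 S \<subseteq> Z1r S \<and>
     closed (Z2r S) \<and> Z2 S \<subseteq> Z2r S"

text \<open>The actual process, started from the state \<open>x\<close> known at time \<open>t\<close>, with \<open>\<sigma> s\<close> the mode in
  force at time \<open>s\<close>.  Auxiliary references are indexed relative to \<open>t\<close>: \<open>v k\<close> is the one applied
  at time \<open>t + k\<close>.  Likewise, step \<open>k\<close> below is time \<open>t + k\<close>; noise processes are indexed by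
  absolute time.\<close>

primrec state ::
    "('mu, 'n::finite, 'm::finite, 'u::finite, 'y::finite, 'e::finite, 'c::finite) plant \<Rightarrow>
     (nat \<Rightarrow> 'mu) \<Rightarrow> ('mu \<Rightarrow> nat \<Rightarrow> 'w \<Rightarrow> real^'n) \<Rightarrow>
     nat \<Rightarrow> real^'n \<Rightarrow> (nat \<Rightarrow> real^'m) \<Rightarrow> nat \<Rightarrow> 'w \<Rightarrow> real^'n" where
  "state S \<sigma> w t x v 0 \<omega> = x"
| "state S \<sigma> w t x v (Suc k) \<omega> =
     A_cl S (\<sigma> (t + k)) *v state S \<sigma> w t x v k \<omega> + B_cl S (\<sigma> (t + k)) *v v k
       + w (\<sigma> (t + k)) (t + k) \<omega>"

definition measured_output where
  "measured_output S \<sigma> w \<xi> t x v k \<omega> = C_out S *v state S \<sigma> w t x v k \<omega> + \<xi> (t + k) \<omega>"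

definition output1 where
  "output1 S \<sigma> w \<zeta> t x v k \<omega> =
     L_x S *v state S \<sigma> w t x v k \<omega> + L_v S *v v k + \<zeta> (t + k) \<omega>"

definition output2 where
  "output2 S \<sigma> w \<eta> t x v k \<omega> =
     F_x S *v state S \<sigma> w t x v k \<omega> + F_v S *v v k + \<eta> (t + k) \<omega>"

text \<open>A single mode change: the fault occurs at some time not later than its detection
  at time \<open>t\<close>.\<close>

definition mode_change :: "(nat \<Rightarrow> 'mu) \<Rightarrow> 'mu \<Rightarrow> 'mu \<Rightarrow> nat \<Rightarrow> bool" where
  "mode_change \<sigma> \<mu> \<mu>' t \<longleftrightarrow> (\<exists>tf\<le>t. (\<forall>s<tf. \<sigma> s = \<mu>) \<and> (\<forall>s\<ge>tf. \<sigma> s = \<mu>'))"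

section \<open>Predictions\<close>

primrec pred_state ::
    "('mu, 'n::finite, 'm::finite, 'u::finite, 'y::finite, 'e::finite, 'c::finite) plant \<Rightarrow>
     'mu \<Rightarrow> real^'n \<Rightarrow> (nat \<Rightarrow> real^'m) \<Rightarrow> nat \<Rightarrow> real^'n"
where
  "pred_state S \<mu> x v 0 = x"
| "pred_state S \<mu> x v (Suc k) = A_cl S \<mu> *v pred_state S \<mu> x v k + B_cl S \<mu> *v v k"

definition pred1 where
  "pred1 S \<mu> x v k = L_x S *v pred_state S \<mu> x v k + L_v S *v v k"

definition pred2 where
  "pred2 S \<mu> x v k = F_x S *v pred_state S \<mu> x v k + F_v S *v v k"

primrec noise_state ::
    "('mu, 'n::finite, 'm::finite, 'u::finite, 'y::finite, 'e::finite, 'c::finite) plant \<Rightarrow>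
     'mu \<Rightarrow> ('mu \<Rightarrow> nat \<Rightarrow> 'w \<Rightarrow> real^'n) \<Rightarrow>
     nat \<Rightarrow> nat \<Rightarrow> 'w \<Rightarrow> real^'n" where
  "noise_state S \<mu> w t 0 \<omega> = 0"
| "noise_state S \<mu> w t (Suc k) \<omega> = A_cl S \<mu> *v noise_state S \<mu> w t k \<omega> + w \<mu> (t + k) \<omega>"

definition noise_output2 where
  "noise_output2 S \<mu> w \<eta> t k \<omega> = F_x S *v noise_state S \<mu> w t k \<omega> + \<eta> (t + k) \<omega>"

section \<open>Safe sets\<close>

text \<open>A tuple \<open>(x, v\<^sub>0, \<dots>, v\<^sub>T)\<close> is encoded as a pair \<open>(x, v)\<close> with \<open>v\<close> a function on the naturals
  whose values beyond \<open>T\<close> are irrelevant.  \<open>P \<mu> k\<close> is the confidence ellipsoid for mode \<open>\<mu>\<close>.\<close>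

definition steady_state where
  "steady_state S \<mu> u = matrix_inv (mat 1 - A_cl S \<mu>) *v (B_cl S \<mu> *v u)"

definition steady1 where
  "steady1 S \<mu> u = (L_x S ** matrix_inv (mat 1 - A_cl S \<mu>) ** B_cl S \<mu> + L_v S) *v u"

definition steady2 where
  "steady2 S \<mu> u = (F_x S ** matrix_inv (mat 1 - A_cl S \<mu>) ** B_cl S \<mu> + F_v S) *v u"

definition tail1 where
  "tail1 S \<mu> T x v k =
     L_x S *v (((*v) (A_cl S \<mu>) ^^ k) (pred_state S \<mu> x v T - steady_state S \<mu> (v T)))
       + steady1 S \<mu> (v T)"

definition tail2 where
  "tail2 S \<mu> T x v k =
     F_x S *v (((*v) (A_cl S \<mu>) ^^ k) (pred_state S \<mu> x v T - steady_state S \<mu> (v T)))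
       + steady2 S \<mu> (v T)"

definition Phi ::
    "('mu, 'n::finite, 'm::finite, 'u::finite, 'y::finite, 'e::finite, 'c::finite) plant \<Rightarrow>
     ('mu \<Rightarrow> nat \<Rightarrow> (real^'c) set) \<Rightarrow> nat \<Rightarrow> 'mu \<Rightarrow> nat \<Rightarrow>
     ((real^'n) \<times> (nat \<Rightarrow> real^'m)) set" where
  "Phi S P T \<mu> k = {(x, v). tail1 S \<mu> T x v k \<in> Z1 S \<and>
                            tail2 S \<mu> T x v k \<in> pontryagin_diff (Z2 S) (P \<mu> k)}"

definition Phi_bar ::
    "('mu, 'n::finite, 'm::finite, 'u::finite, 'y::finite, 'e::finite, 'c::finite) plant \<Rightarrow>
     ('mu \<Rightarrow> nat \<Rightarrow> (real^'c) set) \<Rightarrow> real \<Rightarrow> nat \<Rightarrow> 'mu \<Rightarrow>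
     ((real^'n) \<times> (nat \<Rightarrow> real^'m)) set" where
  "Phi_bar S P \<epsilon> T \<mu> = {(x, v).
     (\<forall>k\<le>T. pred1 S \<mu> x v k \<in> Z1 S \<and> pred2 S \<mu> x v k \<in> pontryagin_diff (Z2 S) (P \<mu> k)) \<and>
     {steady1 S \<mu> (v T)} + ball 0 \<epsilon> \<subseteq> Z1 S \<and>
     {steady2 S \<mu> (v T)} + ball 0 \<epsilon> \<subseteq> (\<Inter>k. pontryagin_diff (Z2 S) (P \<mu> k))}"

definition O_inf where
  "O_inf S P \<epsilon> T \<mu> = Phi_bar S P \<epsilon> T \<mu> \<inter> (\<Inter>k. Phi S P T \<mu> k)"

definition proj_xv0 :: "('x \<times> (nat \<Rightarrow> 'v)) set \<Rightarrow> ('x \<times> 'v) set" where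
  "proj_xv0 W = (\<lambda>(x, v). (x, v 0)) ` W"

section \<open>Recovery\<close>

text \<open>\<open>v i\<close> stands for \<open>v(t + i)\<close>; only the values with \<open>i < Tr\<close> matter.\<close>

definition recovery_feasible ::
    "('mu, 'n::finite, 'm::finite, 'u::finite, 'y::finite, 'e::finite, 'c::finite) plant \<Rightarrow>
     ('mu \<Rightarrow> nat \<Rightarrow> (real^'c) set) \<Rightarrow> real \<Rightarrow> nat \<Rightarrow>
     nat \<Rightarrow> 'mu \<Rightarrow> real^'n \<Rightarrow> (nat \<Rightarrow> real^'m) \<Rightarrow> bool" where
  "recovery_feasible S P \<epsilon> T Tr \<mu> x v \<longleftrightarrow>
     (\<forall>i<Tr. pred1 S \<mu> x v i \<in> Z1r S \<and> pred2 S \<mu> x v i \<in> pontryagin_diff (Z2r S) (P \<mu> i)) \<and>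
     (pred_state S \<mu> x v Tr, v (Tr - 1)) \<in> proj_xv0 (O_inf S P \<epsilon> T \<mu>)"

definition recoverable_set where
  "recoverable_set S P \<epsilon> T Tr \<mu> = {x. \<exists>v. recovery_feasible S P \<epsilon> T Tr \<mu> x v}"

definition ar_cost :: "real^'m^'m \<Rightarrow> real^'m \<Rightarrow> nat \<Rightarrow> (nat \<Rightarrow> real^'m) \<Rightarrow> real" where
  "ar_cost R r Tr v = (\<Sum>i<Tr. (v i - r) \<bullet> (R *v (v i - r)))"

end

theory Submission
  imports Defs
begin

text \<open>
  Every feasible sequence is safe. After detection the mode is constant, so by linearity the true
  output is the noise-free prediction plus a noise term. The noise has mean zero, so the mean of
  \<open>z\<^sub>1\<close> is its prediction (\<open>output1_mean\<close>). If the predicted \<open>z\<^sub>2\<close> lies in the Pontryagin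
  difference of the relaxed set and the confidence ellipsoid, then the true \<open>z\<^sub>2\<close> lies in the
  relaxed set whenever the noise lies in the ellipsoid, an event of probability \<open>\<beta>\<close>
  (\<open>output2_probability\<close>).

  It remains to see that the optimisation problem has a solution. The cost is coercive because \<open>R\<close>
  is positive definite, so for a
  recoverable state this holds once the feasible set is closed (\<open>ar_cost_attains_min\<close>). The
  delicate constraint is the last one: it requires membership in a \<^emph>\<open>projection\<close> of \<open>O_inf\<close>, and
  projections of closed sets need not be closed. Here nothing can be lost at infinity, since
  \<open>O_inf\<close> is cut out by requiring that linear functions of \<open>(x, v\<^sub>0, \<dots>, v\<^sub>T)\<close> lie in compact sets.
  Along a direction in which such a set is unbounded all these functions vanish, so the set is the
  sum of a compact set and a linear subspace, namely the common kernel
  (\<open>compact_plus_subspace_linear_constraints\<close>). Sums of this kind are closed, and they are stable under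
  linear images, linear preimages and intersections.

  Since the number of references \<open>v\<^sub>0, \<dots>, v\<^sub>T\<close> is not fixed by a type, the tuples are not handled in
  one Euclidean space. Instead the projection onto \<open>(x, v\<^sub>0)\<close> is computed by backward recursion
  over the horizon, as in dynamic programming, and every intermediate set lives in the space of
  pairs of a state and a reference (\<open>compact_plus_subspace_admissible_starts\<close>).
\<close>

section \<open>Sums of a compact set and a subspace\<close>

definition compact_plus_subspace :: "'a::euclidean_space set \<Rightarrow> bool" where
  "compact_plus_subspace X \<longleftrightarrow>
     (\<exists>K V. compact K \<and> subspace V \<and> X = (\<Union>k\<in>K. \<Union>v\<in>V. {k + v}))"

lemma compact_plus_subspace_closed:
  assumes "compact_plus_subspace X"
  shows "closed X"
proof -
  obtain K V where "compact K" "subspace V" "X = (\<Union>k\<in>K. \<Union>v\<in>V. {k + v})"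
    using assms unfolding compact_plus_subspace_def by blast
  then show ?thesis using compact_closed_sums[of K V] closed_subspace[of V] by simp
qed

lemma compact_plus_subspace_linear_image:
  fixes f :: "'a::euclidean_space \<Rightarrow> 'b::euclidean_space"
  assumes X: "compact_plus_subspace X" and f: "linear f"
  shows "compact_plus_subspace (f ` X)"
proof -
  obtain K V where "compact K" "subspace V" and X_eq: "X = (\<Union>k\<in>K. \<Union>v\<in>V. {k + v})"
    using X unfolding compact_plus_subspace_def by blast
  then have "compact (f ` K)" "subspace (f ` V)"
    using f by (auto intro: compact_continuous_image linear_continuous_on linear_conv_bounded_linear[THEN iffD1]
        linear_subspace_image)
  moreover have "f ` X = (\<Union>k\<in>f ` K. \<Union>v\<in>f ` V. {k + v})"
    unfolding X_eq by (simp add: image_UN linear_add[OF f])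
  ultimately show ?thesis unfolding compact_plus_subspace_def by blast
qed

text \<open>If solutions \<open>s\<^sub>n\<close> orthogonal to the common kernel were unbounded, a limit of their normalisations
  would be a unit vector. It is killed by every \<open>h\<^sub>i\<close>, because \<open>h\<^sub>i s\<^sub>n\<close> stays bounded while the norm of
  \<open>s\<^sub>n\<close> does not, and it is orthogonal to the common kernel: a contradiction. The index set may be
  infinite, as it is for the constraints on all future outputs.\<close>

lemma bounded_orthogonal_to_kernel:
  fixes h :: "'i \<Rightarrow> 'a::euclidean_space \<Rightarrow> 'b::euclidean_space"
  assumes lin: "\<And>i. i \<in> I \<Longrightarrow> linear (h i)" and bdd: "\<And>i. i \<in> I \<Longrightarrow> bounded (C i)"
  shows "bounded {x. (\<forall>i\<in>I. h i x \<in> C i) \<and> (\<forall>y. (\<forall>i\<in>I. h i y = 0) \<longrightarrow> y \<bullet> x = 0)}"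
    (is "bounded ?K")
proof (rule ccontr)
  assume unbounded: "\<not> bounded ?K"
  define K where "K = ?K"
  have "\<exists>x. x \<in> K \<and> norm x > real n" for n
    using unbounded unfolding K_def[symmetric] bounded_iff by (meson not_le)
  then obtain s where "\<And>n. s n \<in> K \<and> norm (s n) > real n"
    by metis
  then have s: "\<And>n. s n \<in> ?K" "\<And>n. norm (s n) > real n"
    unfolding K_def by blast+
  have pos: "norm (s n) > 0" for n
    by (rule le_less_trans[OF of_nat_0_le_iff s(2)])
  define d where "d n = s n /\<^sub>R norm (s n)" for n
  have "d n \<in> sphere 0 1" for n
    using pos[of n] by (auto simp: d_def)
  then obtain l \<rho> where l: "l \<in> sphere 0 1" and \<rho>: "strict_mono (\<rho> :: nat \<Rightarrow> nat)"
      and lim: "(d \<circ> \<rho>) \<longlonglongrightarrow> l"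
    using seq_compactE[OF compact_imp_seq_compact[OF compact_sphere], of d 0 1] by metis
  have "h i l = 0" if i: "i \<in> I" for i
  proof -
    obtain B where B: "\<And>c. c \<in> C i \<Longrightarrow> norm c \<le> B" using bdd[OF i] unfolding bounded_iff by blast
    have "(\<lambda>n. h i (d (\<rho> n))) \<longlonglongrightarrow> 0"
    proof (rule Lim_null_comparison)
      show "\<forall>\<^sub>F n in sequentially. norm (h i (d (\<rho> n))) \<le> B * inverse (real n)"
      proof (rule eventually_sequentiallyI[of 1])
        fix n :: nat assume n: "1 \<le> n"
        have hb: "norm (h i (s (\<rho> n))) \<le> B" using s(1)[of "\<rho> n"] i B by blast
        then have B0: "B \<ge> 0" by (meson norm_ge_zero order_trans)
        have "real n \<le> norm (s (\<rho> n))"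
          using seq_suble[OF \<rho>, of n] s(2)[of "\<rho> n"] by linarith
        then have "inverse (norm (s (\<rho> n))) \<le> inverse (real n)"
          using n by (intro le_imp_inverse_le) auto
        then have "norm (h i (s (\<rho> n))) * inverse (norm (s (\<rho> n))) \<le> B * inverse (real n)"
          using hb B0 by (intro mult_mono) auto
        then show "norm (h i (d (\<rho> n))) \<le> B * inverse (real n)"
          by (simp add: d_def linear_scale[OF lin[OF i]] mult.commute)
      qed
      show "(\<lambda>n. B * inverse (real n)) \<longlonglongrightarrow> 0"
        by (rule tendsto_mult_right_zero) (rule lim_inverse_n)
    qed
    moreover have "(\<lambda>n. h i (d (\<rho> n))) \<longlonglongrightarrow> h i l"
      using bounded_linear.tendsto[OF linear_conv_bounded_linear[THEN iffD1, OF lin[OF i]] lim]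
      by (simp add: o_def)
    ultimately show ?thesis by (rule LIMSEQ_unique[symmetric])
  qed
  then have "l \<bullet> s (\<rho> n) = 0" for n
    using s(1)[of "\<rho> n"] by blast
  then have "l \<bullet> d (\<rho> n) = 0" for n
    by (simp add: d_def)
  moreover have "(\<lambda>n. l \<bullet> d (\<rho> n)) \<longlonglongrightarrow> l \<bullet> l"
    using tendsto_inner[OF tendsto_const lim] by (simp add: o_def)
  ultimately have "l \<bullet> l = 0" by (simp add: LIMSEQ_const_iff)
  then show False using l by simp
qed

text \<open>The solution set is invariant under translation by the common kernel of the \<open>h\<^sub>i\<close>, and its part
  orthogonal to that kernel is compact.\<close>

lemma compact_plus_subspace_linear_constraints:
  fixes h :: "'i \<Rightarrow> 'a::euclidean_space \<Rightarrow> 'b::euclidean_space"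
  assumes lin: "\<And>i. i \<in> I \<Longrightarrow> linear (h i)" and C: "\<And>i. i \<in> I \<Longrightarrow> compact (C i)"
  shows "compact_plus_subspace {x. \<forall>i\<in>I. h i x \<in> C i}" (is "compact_plus_subspace ?X")
proof -
  define N where "N = {x. \<forall>i\<in>I. h i x = 0}"
  define K where "K = {x. (\<forall>i\<in>I. h i x \<in> C i) \<and> (\<forall>y. (\<forall>i\<in>I. h i y = 0) \<longrightarrow> y \<bullet> x = 0)}"
  have N: "subspace N"
    using lin by (auto simp: N_def subspace_def linear_0 linear_add linear_scale)
  have cl: "closed {x. h i x \<in> C i}" if "i \<in> I" for i
    using closed_vimage[OF compact_imp_closed[OF C[OF that]], of "h i"] lin[OF that]
    by (simp add: vimage_def linear_continuous_on linear_conv_bounded_linear)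
  have "K = (\<Inter>i\<in>I. {x. h i x \<in> C i}) \<inter> (\<Inter>y\<in>N. {x. y \<bullet> x = 0})"
    by (auto simp: K_def N_def)
  moreover have "closed \<dots>"
    using cl by (intro closed_Int closed_INT ballI closed_hyperplane)
  moreover have "bounded K"
    unfolding K_def using lin C by (intro bounded_orthogonal_to_kernel compact_imp_bounded)
  ultimately have K: "compact K" by (simp add: compact_eq_bounded_closed)
  have "x \<in> (\<Union>k\<in>K. \<Union>v\<in>N. {k + v})" if x: "x \<in> ?X" for x
  proof -
    obtain y z where yz: "y \<in> span N" "\<And>w. w \<in> span N \<Longrightarrow> orthogonal z w" "x = y + z"
      using orthogonal_subspace_decomp_exists[of N x] by metis
    then have y: "y \<in> N" using N by (simp add: span_eq_iff[THEN iffD2])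
    then have "z \<in> K" 
      using x yz by (auto simp: K_def N_def linear_add[OF lin] orthogonal_def inner_commute span_base)
    then show ?thesis using y yz(3) \<open>z \<in> K\<close> by (auto simp: add.commute[of y])
  qed
  moreover have "(\<Union>k\<in>K. \<Union>v\<in>N. {k + v}) \<subseteq> ?X"
    by (auto simp: K_def N_def linear_add[OF lin])
  ultimately have "?X = (\<Union>k\<in>K. \<Union>v\<in>N. {k + v})" by blast
  then show ?thesis using K N unfolding compact_plus_subspace_def by blast
qed

text \<open>This converse of \<open>compact_plus_subspace_linear_constraints\<close> turns a sum back into a linear
  constraint, so that intersections and preimages reduce to systems of constraints. Any linear map with
  kernel \<open>V\<close> serves.\<close>

lemma compact_plus_subspace_as_preimage:
  fixes X :: "'a::euclidean_space set"
  assumes "compact_plus_subspace X"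
  obtains f :: "'a \<Rightarrow> 'a" and K where "linear f" "compact K" "X = f -` K"
proof -
  obtain K V where K: "compact K" and V: "subspace V" and X: "X = (\<Union>k\<in>K. \<Union>v\<in>V. {k + v})"
    using assms unfolding compact_plus_subspace_def by blast
  obtain B where B: "B \<subseteq> V" "pairwise orthogonal B" "\<And>b. b \<in> B \<Longrightarrow> norm b = 1" "independent B"
      and "card B = dim V" and span: "span B = V"
    by (rule orthonormal_basis_subspace[OF V]) (rule that)
  have fin: "finite B" using B(4) by (simp add: independent_imp_finite)
  \<comment> \<open>the orthogonal projection onto the complement of \<open>V\<close>\<close>
  define f where "f x = x - (\<Sum>b\<in>B. (b \<bullet> x) *\<^sub>R b)" for x
  have lin: "linear f"
    unfolding f_def
    by (rule linearI)
      (simp_all add: inner_add_right scaleR_add_left sum.distrib scaleR_diff_right scaleR_sum_right)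
  have ker: "f x = 0 \<longleftrightarrow> x \<in> V" for x
  proof
    assume "f x = 0"
    then have "x = (\<Sum>b\<in>B. (b \<bullet> x) *\<^sub>R b)" by (simp add: f_def)
    also have "\<dots> \<in> V" using B(1) V by (auto intro!: subspace_sum subspace_scale)
    finally show "x \<in> V" .
  next
    assume "x \<in> V"
    then have "x \<in> span B" using span by simp
    then show "f x = 0"
    proof (induction rule: span_induct)
      case base
      show ?case using lin by (auto simp: subspace_def linear_0 linear_add linear_scale)
    next
      case (step b)
      have "(c \<bullet> b) *\<^sub>R c = (if c = b then b else 0)" if "c \<in> B" for c
      proof (cases "c = b")
        case True
        then show ?thesis using B(3)[OF step] by (simp add: norm_eq_1)
      next
        case False
        then have "c \<bullet> b = 0"
          using B(2) that step unfolding pairwise_def orthogonal_def by blast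
        then show ?thesis using False by simp
      qed
      then have "(\<Sum>c\<in>B. (c \<bullet> b) *\<^sub>R c) = (\<Sum>c\<in>B. if c = b then b else 0)"
        by (intro sum.cong refl)
      then show ?case using step fin by (simp add: f_def)
    qed
  qed
  have "x \<in> X \<longleftrightarrow> f x \<in> f ` K" for x
  proof
    assume "f x \<in> f ` K"
    then obtain k where "k \<in> K" "f x = f k" by blast
    then have "x - k \<in> V" using ker[of "x - k"] by (simp add: linear_diff[OF lin])
    then have "k + (x - k) \<in> X" using \<open>k \<in> K\<close> unfolding X by blast
    then show "x \<in> X" by simp
  next
    assume "x \<in> X"
    then obtain k v where k: "k \<in> K" and "v \<in> V" "x = k + v" unfolding X by blast
    then have "f x = f k" using ker[of v] by (simp add: linear_add[OF lin])
    then show "f x \<in> f ` K" using k by blast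
  qed
  then have "X = f -` (f ` K)" by (intro set_eqI) (simp only: vimage_eq)
  moreover have "compact (f ` K)"
    using compact_continuous_image[OF linear_continuous_on K, of f] lin
    by (simp add: linear_conv_bounded_linear)
  ultimately show thesis by (intro that[OF lin])
qed

lemma compact_plus_subspace_linear_vimage:
  fixes g :: "'a::euclidean_space \<Rightarrow> 'b::euclidean_space"
  assumes X: "compact_plus_subspace X" and g: "linear g"
  shows "compact_plus_subspace (g -` X)"
proof -
  obtain f :: "'b \<Rightarrow> 'b" and K where f: "linear f" "compact K" and "X = f -` K"
    using X by (rule compact_plus_subspace_as_preimage)
  then have "g -` X = {x. \<forall>i\<in>{()}. (f \<circ> g) x \<in> K}" by auto
  then show ?thesis
    using compact_plus_subspace_linear_constraints[of "{()}" "\<lambda>_. f \<circ> g" "\<lambda>_. K"]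
      linear_compose[OF g f(1)] f(2) by simp
qed

lemma compact_plus_subspace_Int:
  fixes X Y :: "'a::euclidean_space set"
  assumes X: "compact_plus_subspace X" and Y: "compact_plus_subspace Y"
  shows "compact_plus_subspace (X \<inter> Y)"
proof -
  obtain f :: "'a \<Rightarrow> 'a" and K where f: "linear f" "compact K" "X = f -` K"
    using X by (rule compact_plus_subspace_as_preimage)
  obtain g :: "'a \<Rightarrow> 'a" and L where g: "linear g" "compact L" "Y = g -` L"
    using Y by (rule compact_plus_subspace_as_preimage)
  have "X \<inter> Y = {x. \<forall>i\<in>UNIV. (if i then f else g) x \<in> (if i then K else L)}"
    by (auto simp: f g all_bool_eq)
  then show ?thesis
    using compact_plus_subspace_linear_constraints[of UNIV "\<lambda>i. if i then f else g" "\<lambda>i. if i then K else L"] f g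
    by simp
qed

lemma compact_plus_subspace_UNIV:
  "compact_plus_subspace (UNIV :: 'a::euclidean_space set)"
  using compact_plus_subspace_linear_constraints[of "{}" "\<lambda>_ x. x" "\<lambda>_. {} :: 'a set"] by simp

section \<open>Pontryagin differences\<close>

lemma closed_pontryagin_diff:
  fixes X :: "'a::real_normed_vector set"
  assumes "closed X"
  shows "closed (pontryagin_diff X Y)"
proof -
  have "pontryagin_diff X Y = (\<Inter>y\<in>Y. (\<lambda>x. x + y) -` X)"
    by (auto simp: pontryagin_diff_def)
  moreover have "closed ((\<lambda>x. x + y) -` X)" for y
    using assms by (intro closed_vimage continuous_intros)
  ultimately show ?thesis by auto
qed

lemma compact_pontryagin_diff:
  fixes X :: "'a::euclidean_space set"
  assumes X: "compact X" and y: "y \<in> Y"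
  shows "compact (pontryagin_diff X Y)"
proof -
  have "pontryagin_diff X Y \<subseteq> (\<lambda>x. - y + x) ` X"
    using y by (force simp: pontryagin_diff_def)
  then have "bounded (pontryagin_diff X Y)"
    using bounded_subset bounded_translation[OF compact_imp_bounded[OF X]] by blast
  then show ?thesis
    using closed_pontryagin_diff[OF compact_imp_closed[OF X]] by (simp add: compact_eq_bounded_closed)
qed

lemma singleton_plus_subset_iff:
  "{s} + Y \<subseteq> X \<longleftrightarrow> s \<in> pontryagin_diff X Y"
  by (auto simp: pontryagin_diff_def set_plus_def)

text \<open>Confidence ellipsoids are nonempty, so subtracting one from a compact set leaves a compact
  set.\<close>

lemma zero_in_confidence_ellipsoid:
  assumes "confidence_ellipsoid M X \<beta> E"
  shows "0 \<in> E"
proof -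
  obtain c where "c \<ge> 0" "E = ellipsoid (covariance_matrix M X) c"
    using assms by (auto simp: confidence_ellipsoid_def)
  then show ?thesis by (auto simp: ellipsoid_def intro!: exI[of _ 0])
qed

section \<open>The projected safe set is closed\<close>

lemma pred_state_Suc_shift:
  "pred_state S \<mu> x v (Suc j) =
     pred_state S \<mu> (A_cl S \<mu> *v x + B_cl S \<mu> *v v 0) (\<lambda>i. v (Suc i)) j"
  by (induction j) simp_all

lemma linear_matrix_pair:
  "linear (\<lambda>(x, u). A *v x + B *v u)" for A :: "real^'n::finite^'p::finite" and B :: "real^'m::finite^'p"
  by (auto intro!: linearI simp: matrix_vector_right_distrib matrix_vector_mult_scaleR scaleR_add_right)

text \<open>Dynamic programming: a pair \<open>(x, u)\<close> starts an admissible trajectory of length \<open>n + 1\<close> iff it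
  satisfies the first constraint and the successor of \<open>x\<close> under \<open>u\<close> is the first component of a pair
  starting an admissible trajectory of length \<open>n\<close>. That step uses only an intersection, a linear
  preimage and a linear projection.\<close>

lemma compact_plus_subspace_admissible_starts:
  fixes S :: "('mu, 'n::finite, 'm::finite, 'u::finite, 'y::finite, 'e::finite, 'c::finite) plant"
    and Q :: "nat \<Rightarrow> ((real^'n) \<times> (real^'m)) set"
  assumes "\<And>j. j \<le> n \<Longrightarrow> compact_plus_subspace (Q j)"
  shows "compact_plus_subspace {(x, u). \<exists>v. v 0 = u \<and> (\<forall>j\<le>n. (pred_state S \<mu> x v j, v j) \<in> Q j)}"
  using assms
proof (induction n arbitrary: Q)
  case 0
  have "{(x, u). \<exists>v. v 0 = u \<and> (\<forall>j\<le>0. (pred_state S \<mu> x v j, v j) \<in> Q j)} = Q 0"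
    by (auto intro!: exI[of _ "\<lambda>_. _"])
  then show ?case using 0 by simp
next
  case (Suc n)
  let ?G = "\<lambda>n Q. {(x, u). \<exists>v. v 0 = u \<and> (\<forall>j\<le>n. (pred_state S \<mu> x v j, v j) \<in> Q j)}"
  let ?g = "\<lambda>(x, u). A_cl S \<mu> *v x + B_cl S \<mu> *v u"
  have split: "(\<forall>j\<le>Suc n. p j) \<longleftrightarrow> p 0 \<and> (\<forall>j\<le>n. p (Suc j))" for p
    by (metis Suc_le_mono le0 not0_implies_Suc)
  have step: "(x, u) \<in> ?G (Suc n) Q \<longleftrightarrow> (x, u) \<in> Q 0 \<inter> ?g -` (fst ` ?G n (\<lambda>j. Q (Suc j)))" for x u
  proof
    assume "(x, u) \<in> ?G (Suc n) Q"
    then obtain v where "v 0 = u" "(x, u) \<in> Q 0"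
        "\<forall>j\<le>n. (pred_state S \<mu> (?g (x, u)) (\<lambda>i. v (Suc i)) j, v (Suc j)) \<in> Q (Suc j)"
      by (auto simp: split pred_state_Suc_shift simp del: pred_state.simps(2))
    then have "(?g (x, u), v 1) \<in> ?G n (\<lambda>j. Q (Suc j))"
      by (auto intro!: exI[of _ "\<lambda>i. v (Suc i)"])
    then have "?g (x, u) \<in> fst ` ?G n (\<lambda>j. Q (Suc j))"
      by (rule image_eqI[rotated]) simp
    then show "(x, u) \<in> Q 0 \<inter> ?g -` (fst ` ?G n (\<lambda>j. Q (Suc j)))"
      using \<open>(x, u) \<in> Q 0\<close> by blast
  next
    assume "(x, u) \<in> Q 0 \<inter> ?g -` (fst ` ?G n (\<lambda>j. Q (Suc j)))"
    then obtain v where "(x, u) \<in> Q 0"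
        and v: "\<forall>j\<le>n. (pred_state S \<mu> (?g (x, u)) v j, v j) \<in> Q (Suc j)"
      by auto
    then show "(x, u) \<in> ?G (Suc n) Q"
      by (auto simp: split pred_state_Suc_shift simp del: pred_state.simps(2)
          intro!: exI[of _ "case_nat u v"])
  qed
  have "?G (Suc n) Q = Q 0 \<inter> ?g -` (fst ` ?G n (\<lambda>j. Q (Suc j)))"
    by (rule equalityI; rule subrelI) (erule iffD1[OF step], erule iffD2[OF step])
  moreover have "compact_plus_subspace (?G n (\<lambda>j. Q (Suc j)))"
    using Suc.prems by (intro Suc.IH) auto
  then have "compact_plus_subspace (Q 0 \<inter> ?g -` (fst ` ?G n (\<lambda>j. Q (Suc j))))"
    using Suc.prems[of 0]
    by (intro compact_plus_subspace_Int compact_plus_subspace_linear_vimage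
        compact_plus_subspace_linear_image linear_matrix_pair linear_fst) simp_all
  ultimately show ?case by simp
qed

lemma linear_matrix_power:
  "linear ((*v) A ^^ k)" for A :: "real^'n::finite^'n"
proof (induction k)
  case (Suc k)
  show ?case using linear_compose[OF Suc matrix_vector_mul_linear[of A]] by (simp add: o_def)
qed (simp add: linear_id[unfolded id_def] id_def)

text \<open>The constraints in \<open>O_inf\<close> that involve only the predicted state \<open>x\<close> at the horizon and the
  reference \<open>u\<close> held from then on. The margin \<open>\<epsilon>\<close> is expressed by a Pontryagin difference, which
  makes it a constraint with values in a compact set.\<close>

definition terminal_set where
  "terminal_set S P \<epsilon> \<mu> = {(x, u).
     steady1 S \<mu> u \<in> pontryagin_diff (Z1 S) (ball 0 \<epsilon>) \<and>
     steady2 S \<mu> u \<in> pontryagin_diff (\<Inter>k. pontryagin_diff (Z2 S) (P \<mu> k)) (ball 0 \<epsilon>) \<and>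
     (\<forall>k. L_x S *v (((*v) (A_cl S \<mu>) ^^ k) (x - steady_state S \<mu> u)) + steady1 S \<mu> u \<in> Z1 S) \<and>
     (\<forall>k. F_x S *v (((*v) (A_cl S \<mu>) ^^ k) (x - steady_state S \<mu> u)) + steady2 S \<mu> u
        \<in> pontryagin_diff (Z2 S) (P \<mu> k))}"

lemma compact_plus_subspace_terminal_set:
  fixes S :: "('mu, 'n::finite, 'm::finite, 'u::finite, 'y::finite, 'e::finite, 'c::finite) plant"
  assumes Z1: "compact (Z1 S)" and Z2: "compact (Z2 S)" and P: "\<And>k. 0 \<in> P \<mu> k" and \<epsilon>: "\<epsilon> > 0"
  shows "compact_plus_subspace (terminal_set S P \<epsilon> \<mu>)"
proof -
  have D: "compact (pontryagin_diff (Z2 S) (P \<mu> k))" for k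
    using compact_pontryagin_diff[OF Z2 P] .
  have "closed (\<Inter>k. pontryagin_diff (Z2 S) (P \<mu> k))"
    using D by (intro closed_INT ballI compact_imp_closed)
  then have "compact (pontryagin_diff (Z2 S) (P \<mu> 0) \<inter> (\<Inter>k. pontryagin_diff (Z2 S) (P \<mu> k)))"
    by (rule compact_Int_closed[OF D])
  moreover have "pontryagin_diff (Z2 S) (P \<mu> 0) \<inter> (\<Inter>k. pontryagin_diff (Z2 S) (P \<mu> k))
      = (\<Inter>k. pontryagin_diff (Z2 S) (P \<mu> k))" by blast
  ultimately have I: "compact (\<Inter>k. pontryagin_diff (Z2 S) (P \<mu> k))" by metis
  have ss: "linear (\<lambda>u. steady_state S \<mu> u)"
    unfolding steady_state_def using linear_compose[OF matrix_vector_mul_linear matrix_vector_mul_linear]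
    by (simp add: o_def)
  have pair: "linear (\<lambda>z. L *v (((*v) (A_cl S \<mu>) ^^ k) (fst z - steady_state S \<mu> (snd z))) + G *v snd z)"
    for L :: "real^'n^'p::finite" and G :: "real^'m^'p" and k
    by (intro linear_compose_add linear_compose_sub linear_fst linear_snd
        linear_compose[OF _ matrix_vector_mul_linear, unfolded o_def]
        linear_compose[OF _ linear_matrix_power, unfolded o_def]
        linear_compose[OF linear_snd ss, unfolded o_def])
  let ?G1 = "L_x S ** matrix_inv (mat 1 - A_cl S \<mu>) ** B_cl S \<mu> + L_v S"
  let ?G2 = "F_x S ** matrix_inv (mat 1 - A_cl S \<mu>) ** B_cl S \<mu> + F_v S"
  have snd: "linear (\<lambda>z :: (real^'n) \<times> (real^'m). G *v snd z)" for G :: "real^'m^'p::finite"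
    by (intro linear_snd linear_compose[OF _ matrix_vector_mul_linear, unfolded o_def])
  have "terminal_set S P \<epsilon> \<mu> =
      {z. \<forall>i\<in>{()}. ?G1 *v snd z \<in> pontryagin_diff (Z1 S) (ball 0 \<epsilon>)} \<inter>
      ({z. \<forall>i\<in>{()}. ?G2 *v snd z \<in> pontryagin_diff (\<Inter>k. pontryagin_diff (Z2 S) (P \<mu> k)) (ball 0 \<epsilon>)} \<inter>
      ({z. \<forall>k\<in>UNIV. L_x S *v (((*v) (A_cl S \<mu>) ^^ k) (fst z - steady_state S \<mu> (snd z))) + ?G1 *v snd z \<in> Z1 S} \<inter>
       {z. \<forall>k\<in>UNIV. F_x S *v (((*v) (A_cl S \<mu>) ^^ k) (fst z - steady_state S \<mu> (snd z))) + ?G2 *v snd z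
          \<in> pontryagin_diff (Z2 S) (P \<mu> k)}))"
    by (auto simp: terminal_set_def steady1_def steady2_def)
  also have "compact_plus_subspace \<dots>"
    using \<epsilon> compact_pontryagin_diff[OF Z1, of 0 "ball 0 \<epsilon>"] compact_pontryagin_diff[OF I, of 0 "ball 0 \<epsilon>"]
    by (intro compact_plus_subspace_Int compact_plus_subspace_linear_constraints snd pair) (simp_all add: Z1 D)
  finally show ?thesis .
qed

lemma closed_proj_O_inf:
  fixes S :: "('mu, 'n::finite, 'm::finite, 'u::finite, 'y::finite, 'e::finite, 'c::finite) plant"
  assumes Z1: "compact (Z1 S)" and Z2: "compact (Z2 S)" and P: "\<And>k. 0 \<in> P \<mu> k" and \<epsilon>: "\<epsilon> > 0"
  shows "closed (proj_xv0 (O_inf S P \<epsilon> T \<mu>))"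
proof -
  define Q where "Q j = {z. \<forall>i\<in>{()}. (\<lambda>(x, u). L_x S *v x + L_v S *v u) z \<in> Z1 S} \<inter>
      ({z. \<forall>i\<in>{()}. (\<lambda>(x, u). F_x S *v x + F_v S *v u) z \<in> pontryagin_diff (Z2 S) (P \<mu> j)} \<inter>
      (if j = T then terminal_set S P \<epsilon> \<mu> else UNIV))" for j
  have "compact_plus_subspace (Q j)" for j
    unfolding Q_def
    using compact_pontryagin_diff[OF Z2 P] compact_plus_subspace_terminal_set[of S P \<mu>] assms
    by (intro compact_plus_subspace_Int compact_plus_subspace_linear_constraints linear_matrix_pair)
      (simp_all add: compact_plus_subspace_UNIV)
  then have "closed {(x, u). \<exists>v. v 0 = u \<and> (\<forall>j\<le>T. (pred_state S \<mu> x v j, v j) \<in> Q j)}"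
    by (intro compact_plus_subspace_closed compact_plus_subspace_admissible_starts)
  moreover have "(x, v) \<in> O_inf S P \<epsilon> T \<mu> \<longleftrightarrow> (\<forall>j\<le>T. (pred_state S \<mu> x v j, v j) \<in> Q j)" for x v
    by (auto simp: O_inf_def Phi_bar_def Phi_def Q_def terminal_set_def pred1_def pred2_def
        tail1_def tail2_def singleton_plus_subset_iff)
  then have "proj_xv0 (O_inf S P \<epsilon> T \<mu>) = {(x, u). \<exists>v. v 0 = u \<and> (\<forall>j\<le>T. (pred_state S \<mu> x v j, v j) \<in> Q j)}"
    by (force simp: proj_xv0_def image_iff)
  ultimately show ?thesis by simp
qed

section \<open>The recovery problem has a minimiser\<close>

text \<open>The constant is the minimum of the quadratic form on the unit sphere.\<close>

lemma pos_def_matrix_coercive: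
  fixes R :: "real^'m::finite^'m"
  assumes R: "pos_def_matrix R"
  obtains c where "c > 0" "\<And>a. c * (norm a)\<^sup>2 \<le> a \<bullet> (R *v a)"
proof -
  have "continuous_on (sphere 0 1) (\<lambda>a. a \<bullet> (R *v a))"
    by (intro continuous_intros linear_continuous_on matrix_vector_mul_bounded_linear)
  moreover have "sphere (0 :: real^'m) 1 \<noteq> {}" by simp
  ultimately obtain a0 where a0: "a0 \<in> sphere 0 1"
      and min: "\<And>a. a \<in> sphere 0 1 \<Longrightarrow> a0 \<bullet> (R *v a0) \<le> a \<bullet> (R *v a)"
    using continuous_attains_inf[OF compact_sphere, of 0 1 "\<lambda>a. a \<bullet> (R *v a)"] by blast
  show thesis
  proof
    show "a0 \<bullet> (R *v a0) > 0"
      using R a0 unfolding pos_def_matrix_def by (metis mem_sphere_0 norm_zero zero_neq_one)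
    fix a :: "real^'m"
    show "(a0 \<bullet> (R *v a0)) * (norm a)\<^sup>2 \<le> a \<bullet> (R *v a)"
    proof (cases "a = 0")
      case False
      have "a0 \<bullet> (R *v a0) \<le> (a /\<^sub>R norm a) \<bullet> (R *v (a /\<^sub>R norm a))"
        using False by (intro min) simp
      also have "\<dots> = (a \<bullet> (R *v a)) / (norm a)\<^sup>2"
        by (simp add: matrix_vector_mult_scaleR power2_eq_square divide_simps)
      finally show ?thesis using False by (simp add: field_simps)
    qed simp
  qed
qed

lemma ar_cost_cong:
  "(\<And>i. i < Tr \<Longrightarrow> v i = v' i) \<Longrightarrow> ar_cost R r Tr v = ar_cost R r Tr v'"
  by (simp add: ar_cost_def)

text \<open>Sequences are infinite, but cost and feasibility depend only on the first \<open>Tr\<close> entries. Replacing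
  all later entries by \<open>r\<close> and using coercivity confines the candidates to a product of compact sets,
  which is compact by Tychonoff's theorem.\<close>

lemma ar_cost_attains_min:
  fixes F :: "(nat \<Rightarrow> real^'m::finite) set"
  assumes R: "pos_def_matrix R" and F: "closed F" "F \<noteq> {}"
    and local: "\<And>v v'. v \<in> F \<Longrightarrow> (\<And>i. i < Tr \<Longrightarrow> v i = v' i) \<Longrightarrow> v' \<in> F"
  shows "\<exists>v. is_arg_min (ar_cost R r Tr) (\<lambda>v. v \<in> F) v"
proof -
  obtain c where c: "c > 0" "\<And>a. c * (norm a)\<^sup>2 \<le> a \<bullet> (R *v a)"
    using pos_def_matrix_coercive[OF R] by blast
  obtain v0 where v0: "v0 \<in> F" using F(2) by blast
  define J where "J = ar_cost R r Tr"
  \<comment> \<open>no entry of a sequence at least as good as \<open>v0\<close> is farther than \<open>\<rho>\<close> from \<open>r\<close>\<close>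
  define \<rho> where "\<rho> = sqrt (J v0 / c)"
  define K where "K = (\<Pi>\<^sub>E i\<in>UNIV. if i < Tr then cball r \<rho> else {r})"
  define trunc where "trunc v = (\<lambda>i. if i < Tr then v i else r)" for v :: "nat \<Rightarrow> real^'m"
  have J_trunc: "J (trunc v) = J v" for v
    unfolding J_def by (rule ar_cost_cong) (simp add: trunc_def)
  have trunc: "trunc v \<in> K \<inter> F" if v: "v \<in> F" and le: "J v \<le> J v0" for v
  proof
    show "trunc v \<in> F" using v by (rule local) (simp add: trunc_def)
    have "norm (v i - r) \<le> \<rho>" if "i < Tr" for i
    proof -
      have "c * (norm (v i - r))\<^sup>2 \<le> (v i - r) \<bullet> (R *v (v i - r))" by (rule c(2))
      also have "\<dots> \<le> J v"
        unfolding J_def ar_cost_def using that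
        by (intro member_le_sum) (auto intro: order_trans[OF _ c(2)] simp: c(1) less_imp_le)
      finally have "(norm (v i - r))\<^sup>2 \<le> J v0 / c"
        using le c(1) by (simp add: field_simps)
      then show ?thesis unfolding \<rho>_def by (rule real_le_rsqrt)
    qed
    then show "trunc v \<in> K" by (auto simp: K_def trunc_def dist_norm norm_minus_commute)
  qed
  have "compactin (product_topology (\<lambda>i. euclidean) UNIV) K"
    unfolding K_def compactin_PiE by auto
  then have "compact K" by (simp add: euclidean_product_topology)
  then have "compact (K \<inter> F)" using F(1) by (rule compact_Int_closed)
  moreover have "K \<inter> F \<noteq> {}" using trunc[OF v0] by auto
  moreover have "continuous_on (K \<inter> F) J"
    unfolding J_def ar_cost_def
    by (intro continuous_intros continuous_on_compose2[OF matrix_vector_mult_linear_continuous_on]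
       continuous_on_subset[OF continuous_on_product_coordinates]) auto
  ultimately obtain v where v: "v \<in> K \<inter> F" and min: "\<And>u. u \<in> K \<inter> F \<Longrightarrow> J v \<le> J u"
    using continuous_attains_inf[of "K \<inter> F" J] by blast
  have "J v \<le> J u" if u: "u \<in> F" for u
  proof (cases "J u \<le> J v0")
    case True
    then show ?thesis using min[OF trunc[OF u]] by (simp add: J_trunc)
  next
    case False
    then show ?thesis using min[OF trunc[OF v0]] by (simp add: J_trunc)
  qed
  then show ?thesis using v by (auto simp: is_arg_min_def J_def not_less)
qed

lemma pred_state_cong:
  "(\<And>i. i < k \<Longrightarrow> v i = v' i) \<Longrightarrow> pred_state S \<mu> x v k = pred_state S \<mu> x v' k"
  by (induction k) auto

lemma continuous_on_pred_state:
  "continuous_on A (\<lambda>v. pred_state S \<mu> x v k)"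
  by (induction k) (auto intro!: continuous_intros continuous_on_compose2[OF matrix_vector_mult_linear_continuous_on]
       continuous_on_subset[OF continuous_on_product_coordinates])

lemma closed_recovery_feasible:
  fixes S :: "('mu, 'n::finite, 'm::finite, 'u::finite, 'y::finite, 'e::finite, 'c::finite) plant"
  assumes Z1r: "closed (Z1r S)" and Z2r: "closed (Z2r S)"
    and O: "closed (proj_xv0 (O_inf S P \<epsilon> T \<mu>))"
  shows "closed {v. recovery_feasible S P \<epsilon> T Tr \<mu> x v}"
proof -
  have coord: "continuous_on UNIV (\<lambda>v :: nat \<Rightarrow> real^'m. v i)" for i
    by simp
  note mult = continuous_on_compose2[OF matrix_vector_mult_linear_continuous_on]
  have 1: "continuous_on UNIV (\<lambda>v. pred1 S \<mu> x v i)" for i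
    unfolding pred1_def by (intro continuous_intros mult[OF continuous_on_pred_state] mult[OF coord]) auto
  have 2: "continuous_on UNIV (\<lambda>v. pred2 S \<mu> x v i)" for i
    unfolding pred2_def by (intro continuous_intros mult[OF continuous_on_pred_state] mult[OF coord]) auto
  have 3: "continuous_on UNIV (\<lambda>v. (pred_state S \<mu> x v Tr, v (Tr - 1)))"
    by (intro continuous_intros continuous_on_pred_state coord)
  have "{v. recovery_feasible S P \<epsilon> T Tr \<mu> x v} =
     (\<Inter>i\<in>{..<Tr}. (\<lambda>v. pred1 S \<mu> x v i) -` Z1r S \<inter>
                   (\<lambda>v. pred2 S \<mu> x v i) -` pontryagin_diff (Z2r S) (P \<mu> i)) \<inter>
     (\<lambda>v. (pred_state S \<mu> x v Tr, v (Tr - 1))) -` proj_xv0 (O_inf S P \<epsilon> T \<mu>)"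
    by (auto simp: recovery_feasible_def)
  also have "closed \<dots>"
    by (intro closed_Int closed_INT ballI closed_vimage closed_pontryagin_diff assms 1 2 3)
  finally show ?thesis .
qed

lemma recovery_feasible_cong:
  assumes "\<And>i. i < Tr \<Longrightarrow> v i = v' i" and "0 < Tr" and v: "recovery_feasible S P \<epsilon> T Tr \<mu> x v"
  shows "recovery_feasible S P \<epsilon> T Tr \<mu> x v'"
proof -
  have *: "pred_state S \<mu> x v k = pred_state S \<mu> x v' k" if "k \<le> Tr" for k
    using assms(1) that by (intro pred_state_cong) auto
  show ?thesis
    using v assms(1)[of "Tr - 1"] \<open>0 < Tr\<close>
    by (simp add: recovery_feasible_def pred1_def pred2_def * assms(1))
qed

section \<open>Feasible sequences enforce the relaxed constraints\<close>

lemma centred_normal_mean: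
  assumes "centred_normal M s X"
  shows "has_bochner_integral M X 0"
proof (cases "s = 0")
  case True
  then have X: "X \<in> borel_measurable M" "AE \<omega> in M. X \<omega> = 0"
    using assms by (auto simp: centred_normal_def)
  show ?thesis
    by (rule has_bochner_integralI_AE[OF has_bochner_integral_zero X(1)]) (use X(2) in auto)
next
  case False
  then have D: "distributed M lborel X (normal_density 0 (sqrt s))" and s: "0 < sqrt s"
    using assms by (auto simp: centred_normal_def)
  have "integrable M X"
    using distributed_integrable[OF D, of "\<lambda>x. x"] integrable_normal_moment_nz_1[OF s, of 0]
    by (simp add: normal_density_nonneg)
  moreover have "integral\<^sup>L M X = 0"
    using distributed_integral[OF D, of "\<lambda>x. x"] integral_normal_moment_nz_1[OF s, of 0]
    by (simp add: normal_density_nonneg)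
  ultimately show ?thesis by (simp add: has_bochner_integral_iff)
qed

lemma gaussian_vector_mean:
  fixes X :: "'w \<Rightarrow> real^'d::finite"
  assumes "gaussian_vector M H X"
  shows "has_bochner_integral M X 0"
proof -
  have "has_bochner_integral M (\<lambda>\<omega>. \<Sum>b\<in>Basis. (b \<bullet> X \<omega>) *\<^sub>R b) (\<Sum>b\<in>Basis. 0 *\<^sub>R (b :: real^'d))"
    using assms unfolding gaussian_vector_def
    by (intro has_bochner_integral_sum has_bochner_integral_scaleR_left centred_normal_mean) blast+
  then show ?thesis
    by (simp add: inner_commute[of _ "X _"] euclidean_representation)
qed

lemma has_bochner_integral_matrix_vector_mult:
  fixes A :: "real^'n::finite^'p::finite"
  assumes "has_bochner_integral M f y"
  shows "has_bochner_integral M (\<lambda>\<omega>. A *v f \<omega>) (A *v y)"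
  using assms by (rule has_bochner_integral_bounded_linear[OF matrix_vector_mul_bounded_linear])

lemma state_mean:
  assumes M: "prob_space M" and \<sigma>: "\<And>s. s \<ge> t \<Longrightarrow> \<sigma> s = \<mu>"
    and w: "gaussian_process M H (w \<mu>)"
  shows "has_bochner_integral M (state S \<sigma> w t x v k) (pred_state S \<mu> x v k)"
proof (induction k)
  interpret prob_space M by fact
  case 0
  show ?case by (auto simp: has_bochner_integral_iff prob_space)
next
  interpret prob_space M by fact
  case (Suc k)
  have const: "has_bochner_integral M (\<lambda>_. B_cl S \<mu> *v v k) (B_cl S \<mu> *v v k)"
    by (auto simp: has_bochner_integral_iff prob_space)
  have "gaussian_vector M H (w \<mu> (t + k))"
    using w by (simp add: gaussian_process_def)
  from has_bochner_integral_add[OF has_bochner_integral_add[OF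
        has_bochner_integral_matrix_vector_mult[OF Suc, of "A_cl S \<mu>"] const] gaussian_vector_mean[OF this]]
  show ?case by (simp add: \<sigma>)
qed

lemma output1_mean:
  assumes M: "prob_space M" and \<sigma>: "\<And>s. s \<ge> t \<Longrightarrow> \<sigma> s = \<mu>"
    and w: "gaussian_process M H (w \<mu>)" and \<zeta>: "gaussian_vector M H\<^sub>\<zeta> (\<zeta> (t + k))"
  shows "has_bochner_integral M (output1 S \<sigma> w \<zeta> t x v k) (pred1 S \<mu> x v k)"
proof -
  interpret prob_space M by fact
  have const: "has_bochner_integral M (\<lambda>_. L_v S *v v k) (L_v S *v v k)"
    by (auto simp: has_bochner_integral_iff prob_space)
  from has_bochner_integral_add[OF has_bochner_integral_add[OF
        has_bochner_integral_matrix_vector_mult[OF state_mean[where w = w and \<mu> = \<mu> and \<sigma> = \<sigma> and t = t and k = k and S = S and x = x and v = v, OF M \<sigma> w], where A = "L_x S"] const]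
        gaussian_vector_mean[OF \<zeta>]]
  show ?thesis by (simp add: output1_def[abs_def] pred1_def)
qed

lemma state_superposition:
  assumes \<sigma>: "\<And>s. s \<ge> t \<Longrightarrow> \<sigma> s = \<mu>"
  shows "state S \<sigma> w t x v k \<omega> = pred_state S \<mu> x v k + noise_state S \<mu> w t k \<omega>"
  by (induction k) (simp_all add: \<sigma> matrix_vector_right_distrib algebra_simps)

lemma output2_superposition:
  assumes \<sigma>: "\<And>s. s \<ge> t \<Longrightarrow> \<sigma> s = \<mu>"
  shows "output2 S \<sigma> w \<eta> t x v k \<omega> = pred2 S \<mu> x v k + noise_output2 S \<mu> w \<eta> t k \<omega>"
  by (simp add: output2_def pred2_def noise_output2_def state_superposition[OF \<sigma>]
      matrix_vector_right_distrib algebra_simps)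

lemma borel_measurable_matrix_vector_mult:
  fixes A :: "real^'n::finite^'p::finite"
  assumes "f \<in> borel_measurable M"
  shows "(\<lambda>\<omega>. A *v f \<omega>) \<in> borel_measurable M"
  using measurable_compose[OF assms borel_measurable_continuous_onI[of "(*v) A"]]
  by (simp add: linear_continuous_on)

lemma noise_output2_measurable:
  assumes w: "gaussian_process M H (w \<mu>)" and \<eta>: "gaussian_vector M H\<^sub>\<eta> (\<eta> (t + k))"
  shows "noise_output2 S \<mu> w \<eta> t k \<in> borel_measurable M"
proof -
  have "noise_state S \<mu> w t k \<in> borel_measurable M"
  proof (induction k)
    case (Suc k)
    have "w \<mu> (t + k) \<in> borel_measurable M"
      using w by (simp add: gaussian_process_def gaussian_vector_def)
    from borel_measurable_add[OF borel_measurable_matrix_vector_mult[OF Suc, of "A_cl S \<mu>"] this]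
    show ?case by simp
  qed simp
  moreover have "\<eta> (t + k) \<in> borel_measurable M" using \<eta> by (simp add: gaussian_vector_def)
  ultimately show ?thesis
    unfolding noise_output2_def
    by (intro borel_measurable_add borel_measurable_matrix_vector_mult)
qed

lemma output2_probability:
  assumes M: "prob_space M" and \<sigma>: "\<And>s. s \<ge> t \<Longrightarrow> \<sigma> s = \<mu>"
    and w: "gaussian_process M H (w \<mu>)" and \<eta>: "gaussian_vector M H\<^sub>\<eta> (\<eta> (t + k))"
    and E: "confidence_ellipsoid M (noise_output2 S \<mu> w \<eta> t k) \<beta> E"
    and Z: "closed Z" and pred: "pred2 S \<mu> x v k \<in> pontryagin_diff Z E"
  shows "measure M {\<omega> \<in> space M. output2 S \<sigma> w \<eta> t x v k \<omega> \<in> Z} \<ge> \<beta>"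
proof -
  interpret prob_space M by fact
  have meas: "output2 S \<sigma> w \<eta> t x v k \<in> borel_measurable M"
    using noise_output2_measurable[where w = w and \<eta> = \<eta> and \<mu> = \<mu>, OF w \<eta>, of S] by (simp add: output2_superposition[OF \<sigma>] cong: measurable_cong)
  have "\<beta> = measure M {\<omega> \<in> space M. noise_output2 S \<mu> w \<eta> t k \<omega> \<in> E}"
    using E by (simp add: confidence_ellipsoid_def)
  also have "\<dots> \<le> measure M {\<omega> \<in> space M. output2 S \<sigma> w \<eta> t x v k \<omega> \<in> Z}"
  proof (rule finite_measure_mono)
    show "{\<omega> \<in> space M. noise_output2 S \<mu> w \<eta> t k \<omega> \<in> E}
        \<subseteq> {\<omega> \<in> space M. output2 S \<sigma> w \<eta> t x v k \<omega> \<in> Z}"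
      using pred by (auto simp: pontryagin_diff_def output2_superposition[OF \<sigma>])
    show "{\<omega> \<in> space M. output2 S \<sigma> w \<eta> t x v k \<omega> \<in> Z} \<in> sets M"
      using measurable_sets[OF meas borel_closed[OF Z]] by (simp add: vimage_def Int_def conj_commute)
  qed
  finally show ?thesis .
qed

theorem lemma16:
  fixes S :: "('mu, 'n::finite, 'm::finite, 'u::finite, 'y::finite, 'e::finite, 'c::finite) plant"
    and M :: "'w measure"
    and w :: "'mu \<Rightarrow> nat \<Rightarrow> 'w \<Rightarrow> real^'n" and \<xi> :: "nat \<Rightarrow> 'w \<Rightarrow> real^'y"
    and \<zeta> :: "nat \<Rightarrow> 'w \<Rightarrow> real^'e" and \<eta> :: "nat \<Rightarrow> 'w \<Rightarrow> real^'c"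
    and H\<^sub>w :: "'mu \<Rightarrow> real^'n^'n" and H\<^sub>\<xi> :: "real^'y^'y"
    and H\<^sub>\<zeta> :: "real^'e^'e" and H\<^sub>\<eta> :: "real^'c^'c"
    and P :: "'mu \<Rightarrow> nat \<Rightarrow> (real^'c) set"
    and \<beta> \<epsilon> :: real and T Te Tr t :: nat
    and R :: "real^'m^'m" and r :: "real^'m"
    and \<sigma> :: "nat \<Rightarrow> 'mu" and \<mu> \<mu>' :: 'mu
    and x :: "real^'n"
  assumes plant: "admissible_plant S"
    and prob: "prob_space M"
    and w: "\<And>\<nu>. \<nu> \<in> modes S \<Longrightarrow> gaussian_process M (H\<^sub>w \<nu>) (w \<nu>)"
    and \<xi>: "gaussian_process M H\<^sub>\<xi> \<xi>"
    and indep: "\<And>\<nu>. \<nu> \<in> modes S \<Longrightarrow>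
                  prob_space.indep_set M (process_events M (w \<nu>)) (process_events M \<xi>)"
    and \<zeta>: "\<And>s. gaussian_vector M H\<^sub>\<zeta> (\<zeta> s)"
    and \<eta>: "\<And>s. gaussian_vector M H\<^sub>\<eta> (\<eta> s)"
    and P: "\<And>\<nu> k. \<nu> \<in> modes S \<Longrightarrow>
              confidence_ellipsoid M (noise_output2 S \<nu> w \<eta> t k) \<beta> (P \<nu> k)"
    and \<epsilon>: "\<epsilon> > 0" and T: "T > 0"
    and Te: "Te \<ge> 2" and Tr: "0 < Tr" "Tr < Te"
    and R: "pos_def_matrix R"
    and \<mu>: "\<mu> \<in> modes S" and \<mu>': "\<mu>' \<in> modes S"
    and change: "mode_change \<sigma> \<mu> \<mu>' t"
    and x: "x \<in> recoverable_set S P \<epsilon> T Tr \<mu>'"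
  shows "(\<exists>v. is_arg_min (ar_cost R r Tr) (recovery_feasible S P \<epsilon> T Tr \<mu>' x) v) \<and>
    (\<forall>v. is_arg_min (ar_cost R r Tr) (recovery_feasible S P \<epsilon> T Tr \<mu>' x) v \<longrightarrow>
       (\<forall>k<Tr. integrable M (output1 S \<sigma> w \<zeta> t x v k) \<and>
               integral\<^sup>L M (output1 S \<sigma> w \<zeta> t x v k) \<in> Z1r S \<and>
               measure M {\<omega> \<in> space M. output2 S \<sigma> w \<eta> t x v k \<omega> \<in> Z2r S} \<ge> \<beta>) \<and>
       (pred_state S \<mu>' x v Tr, v (Tr - 1)) \<in> proj_xv0 (O_inf S P \<epsilon> T \<mu>'))"
proof -
  have \<sigma>: "\<And>s. t \<le> s \<Longrightarrow> \<sigma> s = \<mu>'"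
    using change by (auto simp: mode_change_def)
  have closed_r: "closed (Z1r S)" "closed (Z2r S)" and compact: "compact (Z1 S)" "compact (Z2 S)"
    using plant by (simp_all add: admissible_plant_def)
  define F where "F = {v. recovery_feasible S P \<epsilon> T Tr \<mu>' x v}"
  have "closed F"
    unfolding F_def using zero_in_confidence_ellipsoid[OF P[OF \<mu>']] \<epsilon>
    by (intro closed_recovery_feasible closed_proj_O_inf closed_r compact)
  moreover have "F \<noteq> {}"
    using x by (auto simp: F_def recoverable_set_def)
  moreover have "v' \<in> F" if "v \<in> F" "\<And>i. i < Tr \<Longrightarrow> v i = v' i" for v v'
    using that recovery_feasible_cong[of Tr v v'] Tr(1) by (simp add: F_def)
  ultimately have "\<exists>v. is_arg_min (ar_cost R r Tr) (\<lambda>v. v \<in> F) v"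
    by (rule ar_cost_attains_min[OF R])
  then have "\<exists>v. is_arg_min (ar_cost R r Tr) (recovery_feasible S P \<epsilon> T Tr \<mu>' x) v"
    by (simp add: F_def)
  moreover have "(\<forall>k<Tr. integrable M (output1 S \<sigma> w \<zeta> t x v k) \<and>
               integral\<^sup>L M (output1 S \<sigma> w \<zeta> t x v k) \<in> Z1r S \<and>
               measure M {\<omega> \<in> space M. output2 S \<sigma> w \<eta> t x v k \<omega> \<in> Z2r S} \<ge> \<beta>) \<and>
       (pred_state S \<mu>' x v Tr, v (Tr - 1)) \<in> proj_xv0 (O_inf S P \<epsilon> T \<mu>')"
    if "is_arg_min (ar_cost R r Tr) (recovery_feasible S P \<epsilon> T Tr \<mu>' x) v" for v
  proof (intro conjI allI impI)
    have feasible: "recovery_feasible S P \<epsilon> T Tr \<mu>' x v"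
      using that by (simp add: is_arg_min_def)
    then show "(pred_state S \<mu>' x v Tr, v (Tr - 1)) \<in> proj_xv0 (O_inf S P \<epsilon> T \<mu>')"
      by (simp add: recovery_feasible_def)
    fix k assume "k < Tr"
    then have pred: "pred1 S \<mu>' x v k \<in> Z1r S"
        "pred2 S \<mu>' x v k \<in> pontryagin_diff (Z2r S) (P \<mu>' k)"
      using feasible by (auto simp: recovery_feasible_def)
    have mean: "has_bochner_integral M (output1 S \<sigma> w \<zeta> t x v k) (pred1 S \<mu>' x v k)"
      using prob \<sigma> w[OF \<mu>'] \<zeta> by (rule output1_mean)
    then show "integrable M (output1 S \<sigma> w \<zeta> t x v k)"
      by (rule integrable.intros)
    show "integral\<^sup>L M (output1 S \<sigma> w \<zeta> t x v k) \<in> Z1r S"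
      using pred(1) has_bochner_integral_integral_eq[OF mean] by simp
    show "measure M {\<omega> \<in> space M. output2 S \<sigma> w \<eta> t x v k \<omega> \<in> Z2r S} \<ge> \<beta>"
      using prob \<sigma> w[OF \<mu>'] \<eta> P[OF \<mu>'] closed_r(2) pred(2) by (rule output2_probability)
  qed
  ultimately show ?thesis by blast
qed


end
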